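(* Let $V:\mathbb{R}^d\to\mathbb{R}$ satisfy the assumptions (V-a)–(V-d), let the proximal function $d(\cdot,\cdot)$ satisfy the assumptions (D-a)–(D-c), and let $\alpha,\beta\in\mathbb{R}$ with $\alpha+\beta>1$ (assumptions and notation as listed in the context). There exists a positive constant $\bar\rho>0$ such that for every penalty factor $\rho>\bar\rho$ and every $x^*\in\mathbb{R}^d$ the following two statements are equivalent: 1. $x^*$ is an index-1 saddle point of $V$; 2. $(x^*,x^*,\mathbf{v}_1(x^* ))$ is a strict pure Nash equilibrium of the game $G_3$, where $\mathbf{v}_1(x^* )$ is the (normalized) eigenvector of the Hessian matrix $H(x^* )=\nabla^2V(x^* )$ corresponding to the smallest eigenvalue $\lambda_1(x^* )$.
   Context: Notation. For $V:\mathbb{R}^d\to\mathbb{R}$, $H(x)=\nabla^2V(x)$; $\lambda_1(x)\le\dots\le\lambda_d(x)$ are the eigenvalues of $H(x)$ in ascending order, and $\mathbf{v}_1(x)$ is the normalized eigenvector of $H(x)$ for $\lambda_1(x)$, determined up to sign. $\mathbb{S}^{d-1}$ is the Euclidean unit sphere in $\mathbb{R}^d$. $\lambda_{\min}(A),\lambda_{\max}(A)$ denote the smallest and largest eigenvalue of a symmetric matrix $A$. The letter $d$ denotes the dimension, while $d(\cdot,\cdot):\mathbb{R}^d\times\mathbb{R}^d\to\mathbb{R}$ denotes the proximal function. An index-1 saddle point of $V$ is a point $x^*$ with $\nabla V(x^* )=0$ and $\lambda_1(x^* )<0<\lambda_2(x^* )\le\dots\le\lambda_d(x^* )$; $\mathcal{S}_1$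 is the set of all of them. Auxiliary functions. For $x,y\in\mathbb{R}^d$, $\mathbf{u}\in\mathbb{S}^{d-1}$, $\rho>0$, $$W(y;x,\mathbf{u})=(1-\alpha)V(y)+\alpha V\big(y-\mathbf{u}\mathbf{u}^\top(y-x)\big)-\beta V\big(x+\mathbf{u}\mathbf{u}^\top(y-x)\big),$$ $$\widetilde W_\rho(y;x,\mathbf{u})=W(y;x,\mathbf{u})+\rho\, d(x,y).$$ Game $G_3$. Three players, each minimizing its own cost; an action profile is written $(y,x,\mathbf{u})$: player "$-1$" chooses $y\in\mathbb{R}^d$ with cost $\widetilde W_\rho(y;x,\mathbf{u})$; player "$0$" chooses $x\in\mathbb{R}^d$ with cost $\frac12\|x-y\|^2$; player "$1$" chooses $\mathbf{u}\in\mathbb{S}^{d-1}$ with cost $\mathbf{u}^\top H(x)\mathbf{u}$. An action profile is a pure Nash equilibrium if no player can lower its own cost by changing only its own action (over its whole action space) while the other players' actions are fixed. It is strict if every such unilateral change to a different action strictly increases that player's cost, where the actions $\mathbf{u}$ and $-\mathbf{u}$ of player "$1$" are regarded as the same action (all costs depend on $\mathbf{u}$ only through $\mathbf{u}\mathbf{u}^\top$). Assumptions on $d(\cdot,\cdot)$: (D-a) for any $x$, $d(x,y)$ is convex and $C^2$ in $y$, and $\nabla_y^2d(x,y)=0$ if and only if $y=x$; (D-b) $d(x,y)\ge0$ for all $x,y$, and $d(x,y)=0$ if and only if $x=y$; (D-c) for any constant $\epsilon>0$ there is a positive constant $\bar\lambda_\epsilon>0$ such that $\inf_{\|x-y\|\ge\epsilon}\lambda_{\min}(\nabla_y^2d(x,y))\ge\bar\lambda_\epsilon$.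 Assumptions on $V$: (V-a) $V\in\mathcal{C}^3(\mathbb{R}^d)$ and $V$ is Lipschitz continuous; (V-b) $\mathcal{S}_1$ is non-empty and finite; (V-c) $\nabla^2V$ is uniformly bounded: there are constants $\bar\lambda_L,\bar\lambda_U$ with $\bar\lambda_L\le\lambda_{\min}(\nabla^2V(x))\le\lambda_{\max}(\nabla^2V(x))\le\bar\lambda_U$ for all $x\in\mathbb{R}^d$; (V-d) all stationary points of $V$ are non-degenerate; that is, for all $x\in\mathbb{R}^d$ and $i\in\{1,\dots,d\}$, $\lambda_i(x)\ne0$, and $\lambda_i(x)\ne\lambda_j(x)$ for all $i\ne j$. *)

theory Defs
  imports "HOL-Analysis.Analysis"
begin

definition partial_deriv :: "'n \<Rightarrow> (real ^ 'n \<Rightarrow> real) \<Rightarrow> real ^ 'n::finite \<Rightarrow> real" where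
  "partial_deriv i f x = frechet_derivative f (at x) (axis i 1)"

definition grad :: "(real ^ 'n \<Rightarrow> real) \<Rightarrow> real ^ 'n::finite \<Rightarrow> real ^ 'n" where
  "grad f x = (\<chi> i. partial_deriv i f x)"

definition hessian :: "(real ^ 'n \<Rightarrow> real) \<Rightarrow> real ^ 'n::finite \<Rightarrow> real ^ 'n ^ 'n" where
  "hessian f x = jacobian (grad f) (at x)"

primrec C_k :: "nat \<Rightarrow> (real ^ 'n::finite \<Rightarrow> real) \<Rightarrow> bool" where
  "C_k 0 f \<longleftrightarrow> continuous_on UNIV f"
| "C_k (Suc k) f \<longleftrightarrow> (\<forall>x. f differentiable (at x)) \<and> (\<forall>i. C_k k (partial_deriv i f))"

definition eigenspace :: "real ^ 'n ^ 'n \<Rightarrow> real \<Rightarrow> (real ^ 'n::finite) set" where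
  "eigenspace A l = {v. A *v v = l *\<^sub>R v}"

definition eigenvalues :: "real ^ 'n ^ 'n::finite \<Rightarrow> real set" where
  "eigenvalues A = {l. \<exists>v. v \<noteq> 0 \<and> v \<in> eigenspace A l}"

definition lambda_min :: "real ^ 'n ^ 'n::finite \<Rightarrow> real" where
  "lambda_min A = Min (eigenvalues A)"

definition lambda_max :: "real ^ 'n ^ 'n::finite \<Rightarrow> real" where
  "lambda_max A = Max (eigenvalues A)"

text \<open>
  The eigenvalues in ascending order, each repeated according to its multiplicity. The multiplicity
  is the dimension of the eigenspace; this agrees with the algebraic multiplicity, and the list has
  length \<^term>\<open>CARD('n)\<close>, because all matrices in question are symmetric (Hessians of functions that
  are at least twice continuously differentiable).
\<close>

definition eigenvalue_list :: "real ^ 'n ^ 'n::finite \<Rightarrow> real list" where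
  "eigenvalue_list A =
     concat (map (\<lambda>l. replicate (dim (eigenspace A l)) l) (sorted_list_of_set (eigenvalues A)))"

text \<open>Eigenvalues are numbered from 1 to \<^term>\<open>CARD('n)\<close>.\<close>

definition eigval :: "nat \<Rightarrow> (real ^ 'n \<Rightarrow> real) \<Rightarrow> real ^ 'n::finite \<Rightarrow> real" where
  "eigval i V x = eigenvalue_list (hessian V x) ! (i - 1)"

text \<open>
  The vector \<open>v\<^sub>1(x)\<close> is determined only up to sign (and only if the smallest eigenvalue is simple),
  so it is rendered as a predicate.
\<close>

definition is_v1 :: "(real ^ 'n \<Rightarrow> real) \<Rightarrow> real ^ 'n::finite \<Rightarrow> real ^ 'n \<Rightarrow> bool" where
  "is_v1 V x v \<longleftrightarrow> norm v = 1 \<and> v \<in> eigenspace (hessian V x) (eigval 1 V x)"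

definition index1_saddle :: "(real ^ 'n \<Rightarrow> real) \<Rightarrow> real ^ 'n::finite \<Rightarrow> bool" where
  "index1_saddle V x \<longleftrightarrow>
     grad V x = 0 \<and> eigval 1 V x < 0 \<and> (\<forall>i \<in> {2..CARD('n)}. 0 < eigval i V x)"

definition proximal_function :: "(real ^ 'n::finite \<Rightarrow> real ^ 'n \<Rightarrow> real) \<Rightarrow> bool" where
  "proximal_function d \<longleftrightarrow>
     (\<forall>x. convex_on UNIV (d x) \<and> C_k 2 (d x) \<and> (\<forall>y. hessian (d x) y = 0 \<longleftrightarrow> y = x)) \<and>
     (\<forall>x y. 0 \<le> d x y \<and> (d x y = 0 \<longleftrightarrow> x = y)) \<and>
     (\<forall>\<epsilon>>0. \<exists>l>0. \<forall>x y. \<epsilon> \<le> norm (x - y) \<longrightarrow> l \<le> lambda_min (hessian (d x) y))"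

definition admissible_potential :: "(real ^ 'n::finite \<Rightarrow> real) \<Rightarrow> bool" where
  "admissible_potential V \<longleftrightarrow>
     C_k 3 V \<and> (\<exists>L. L-lipschitz_on UNIV V) \<and>
     {x. index1_saddle V x} \<noteq> {} \<and> finite {x. index1_saddle V x} \<and>
     (\<exists>lL lU. \<forall>x. lL \<le> lambda_min (hessian V x) \<and>
        lambda_min (hessian V x) \<le> lambda_max (hessian V x) \<and> lambda_max (hessian V x) \<le> lU) \<and>
     (\<forall>x. \<forall>i \<in> {1..CARD('n)}. eigval i V x \<noteq> 0 \<and>
        (\<forall>j \<in> {1..CARD('n)}. i \<noteq> j \<longrightarrow> eigval i V x \<noteq> eigval j V x))"

text \<open>The product of the rank-one matrix \<open>u u\<^sup>T\<close> with the vector \<open>z\<close>.\<close>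

definition proj :: "real ^ 'n \<Rightarrow> real ^ 'n \<Rightarrow> real ^ 'n::finite" where
  "proj u z = (u \<bullet> z) *\<^sub>R u"

definition W :: "real \<Rightarrow> real \<Rightarrow> (real ^ 'n \<Rightarrow> real) \<Rightarrow> real ^ 'n::finite \<Rightarrow> real ^ 'n \<Rightarrow> real ^ 'n \<Rightarrow> real"
  where
  "W \<alpha> \<beta> V y x u =
     (1 - \<alpha>) * V y + \<alpha> * V (y - proj u (y - x)) - \<beta> * V (x + proj u (y - x))"

text \<open>
  The costs of the players \<open>-1\<close>, \<open>0\<close> and \<open>1\<close> at the action profile \<open>(y, x, u)\<close>. The action spaces
  are the whole space for \<open>y\<close> and \<open>x\<close>, and the unit sphere for \<open>u\<close>.
\<close>

definition cost_y :: "real \<Rightarrow> real \<Rightarrow> real \<Rightarrow> (real ^ 'n \<Rightarrow> real) \<Rightarrow> (real ^ 'n \<Rightarrow> real ^ 'n \<Rightarrow> real) \<Rightarrow>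
    real ^ 'n::finite \<Rightarrow> real ^ 'n \<Rightarrow> real ^ 'n \<Rightarrow> real" where
  "cost_y \<alpha> \<beta> \<rho> V d y x u = W \<alpha> \<beta> V y x u + \<rho> * d x y"

definition cost_x :: "real ^ 'n::finite \<Rightarrow> real ^ 'n \<Rightarrow> real ^ 'n \<Rightarrow> real" where
  "cost_x y x u = 1 / 2 * (norm (x - y))\<^sup>2"

definition cost_u :: "(real ^ 'n \<Rightarrow> real) \<Rightarrow> real ^ 'n::finite \<Rightarrow> real ^ 'n \<Rightarrow> real ^ 'n \<Rightarrow> real" where
  "cost_u V y x u = u \<bullet> (hessian V x *v u)"

definition nash_equilibrium :: "real \<Rightarrow> real \<Rightarrow> real \<Rightarrow> (real ^ 'n \<Rightarrow> real) \<Rightarrow>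
    (real ^ 'n \<Rightarrow> real ^ 'n \<Rightarrow> real) \<Rightarrow> real ^ 'n::finite \<Rightarrow> real ^ 'n \<Rightarrow> real ^ 'n \<Rightarrow> bool" where
  "nash_equilibrium \<alpha> \<beta> \<rho> V d y x u \<longleftrightarrow>
     u \<in> sphere 0 1 \<and>
     (\<forall>y'. cost_y \<alpha> \<beta> \<rho> V d y x u \<le> cost_y \<alpha> \<beta> \<rho> V d y' x u) \<and>
     (\<forall>x'. cost_x y x u \<le> cost_x y x' u) \<and>
     (\<forall>u' \<in> sphere 0 1. cost_u V y x u \<le> cost_u V y x u')"

text \<open>In strictness, \<open>u\<close> and \<open>-u\<close> count as the same action.\<close>

definition strict_nash_equilibrium :: "real \<Rightarrow> real \<Rightarrow> real \<Rightarrow> (real ^ 'n \<Rightarrow> real) \<Rightarrow>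
    (real ^ 'n \<Rightarrow> real ^ 'n \<Rightarrow> real) \<Rightarrow> real ^ 'n::finite \<Rightarrow> real ^ 'n \<Rightarrow> real ^ 'n \<Rightarrow> bool" where
  "strict_nash_equilibrium \<alpha> \<beta> \<rho> V d y x u \<longleftrightarrow>
     nash_equilibrium \<alpha> \<beta> \<rho> V d y x u \<and>
     (\<forall>y'. y' \<noteq> y \<longrightarrow> cost_y \<alpha> \<beta> \<rho> V d y x u < cost_y \<alpha> \<beta> \<rho> V d y' x u) \<and>
     (\<forall>x'. x' \<noteq> x \<longrightarrow> cost_x y x u < cost_x y x' u) \<and>
     (\<forall>u' \<in> sphere 0 1. u' \<noteq> u \<and> u' \<noteq> - u \<longrightarrow> cost_u V y x u < cost_u V y x u')"

end

theory Submission
  imports Defs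
begin

text \<open>
  Let \<open>v\<close> be a unit eigenvector of \<open>H = H(x)\<close> for its smallest eigenvalue \<open>\<lambda>\<close>, and write
  \<open>h = a v + w\<close> with \<open>w\<close> orthogonal to \<open>v\<close>. At a critical point the second-order part of
  \<open>W(x + h) - W(x)\<close> is half of \<open>(1 - \<alpha> - \<beta>) \<lambda> a\<^sup>2 + w \<bullet> H w\<close>. At an index-1 saddle this form is
  positive definite, so \<open>W\<close> has a strict local minimum at \<open>x\<close>. Away from \<open>x\<close> the function \<open>W\<close>
  decreases at most linearly, by the Lipschitz condition, whereas \<open>d(x, \<cdot>)\<close> grows at least
  linearly: it is convex, vanishes at \<open>x\<close> and has a positive minimum on a small sphere around \<open>x\<close>.
  A large \<open>\<rho>\<close> thus makes the minimum global and strict, and one \<open>\<rho>\<close> serves all of the finitely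
  many saddles.

  Conversely, \<open>d(x, \<cdot>)\<close> vanishes to second order at \<open>x\<close>. The first-order condition of player
  \<open>-1\<close> hence forces \<open>\<nabla>V(x) = 0\<close>, and the second-order condition makes the above form
  nonnegative. Together with the nondegeneracy of \<open>H\<close> this gives \<open>\<lambda> < 0\<close> and makes all other
  eigenvalues positive.
\<close>

subsection \<open>Second-order calculus\<close>

lemma C_k_Suc_imp_C_k: "C_k (Suc k) f \<Longrightarrow> C_k k f"
proof (induction k arbitrary: f)
  case 0
  then show ?case
    by (auto intro!: continuous_at_imp_continuous_on differentiable_imp_continuous_within)
qed simp

lemma has_derivative_grad:
  assumes "f differentiable (at x)"
  shows "(f has_derivative (\<lambda>h. grad f x \<bullet> h)) (at x)"
proof -
  let ?F = "frechet_derivative f (at x)"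
  have F: "(f has_derivative ?F) (at x)"
    using assms frechet_derivative_works by blast
  then have lin: "linear ?F"
    by (rule has_derivative_linear)
  have "?F h = grad f x \<bullet> h" for h
  proof -
    have "?F h = ?F (\<Sum>i\<in>UNIV. h $ i *\<^sub>R axis i 1)"
      using basis_expansion[of h] by (simp add: scalar_mult_eq_scaleR)
    also have "\<dots> = (\<Sum>i\<in>UNIV. h $ i * ?F (axis i 1))"
      by (simp add: linear_sum[OF lin] linear_cmul[OF lin])
    also have "\<dots> = grad f x \<bullet> h"
      by (simp add: grad_def partial_deriv_def inner_vec_def mult.commute)
    finally show ?thesis .
  qed
  then have "?F = (\<lambda>h. grad f x \<bullet> h)"
    by (rule ext)
  with F show ?thesis
    by simp
qed

lemma has_derivative_hessian:
  assumes "\<And>i. partial_deriv i f differentiable (at x)"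
  shows "(grad f has_derivative (\<lambda>h. hessian f x *v h)) (at x)"
proof -
  have "(\<lambda>y. grad f y \<bullet> b) differentiable (at x)" if b: "b \<in> Basis" for b
  proof -
    obtain i where "b = axis i 1"
      using b by (auto simp: Basis_vec_def)
    then have "(\<lambda>y. grad f y \<bullet> b) = partial_deriv i f"
      by (auto simp: grad_def inner_axis)
    then show ?thesis
      using assms by simp
  qed
  then have "grad f differentiable (at x)"
    using differentiable_componentwise_within by blast
  then show ?thesis
    unfolding hessian_def by (simp flip: jacobian_works)
qed

lemma
  assumes "C_k 2 f"
  shows C_2_has_derivative_grad: "(f has_derivative (\<lambda>h. grad f x \<bullet> h)) (at x)"
    and C_2_has_derivative_hessian: "(grad f has_derivative (\<lambda>h. hessian f x *v h)) (at x)"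
  using assms
  by (auto simp: numeral_2_eq_2 intro!: has_derivative_grad has_derivative_hessian)

section \<open>Expansions along lines and symmetry of the Hessian\<close>

lemma has_field_derivative_line:
  assumes "\<And>x. (f has_derivative (\<lambda>h. grad f x \<bullet> h)) (at x)"
  shows "((\<lambda>t. f (x + t *\<^sub>R h)) has_real_derivative grad f (x + t *\<^sub>R h) \<bullet> h) (at t)"
proof -
  have "((\<lambda>t. x + t *\<^sub>R h) has_derivative (\<lambda>s. s *\<^sub>R h)) (at t)"
    by (auto intro!: derivative_eq_intros)
  then have "((\<lambda>t. f (x + t *\<^sub>R h)) has_derivative (\<lambda>s. grad f (x + t *\<^sub>R h) \<bullet> (s *\<^sub>R h))) (at t)"
    by (rule has_derivative_compose[OF _ assms])
  then show ?thesis
    by (simp add: has_field_derivative_def mult_commute_abs)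
qed

text \<open>The mean value theorem is applied on a segment to f minus its quadratic Taylor
  polynomial. The derivative of this difference is the linearization error of the gradient at x,
  paired with h, so differentiability of the gradient gives a remainder of Peano type.\<close>

lemma second_order_Taylor:
  assumes f: "C_k 2 f" and "e > 0"
  obtains \<delta> where "\<delta> > 0"
    "\<And>h. norm h < \<delta> \<Longrightarrow>
       \<bar>f (x + h) - f x - grad f x \<bullet> h - h \<bullet> (hessian f x *v h) / 2\<bar> \<le> e * (norm h)\<^sup>2"
proof -
  let ?H = "hessian f x"
  obtain \<delta> where "\<delta> > 0" and \<delta>: "\<And>y. norm (y - x) < \<delta> \<Longrightarrow>
      norm (grad f y - grad f x - ?H *v (y - x)) \<le> e * norm (y - x)"
    using C_2_has_derivative_hessian[OF f, of x] \<open>e > 0\<close> unfolding has_derivative_at_alt by blast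
  have "\<bar>f (x + h) - f x - grad f x \<bullet> h - h \<bullet> (?H *v h) / 2\<bar> \<le> e * (norm h)\<^sup>2"
    if h: "norm h < \<delta>" for h
  proof -
    \<comment> \<open>\<open>\<phi> 1 - \<phi> 0\<close> is exactly the remainder to be
      bounded.\<close>
    define \<phi> where "\<phi> t = f (x + t *\<^sub>R h) - t * (grad f x \<bullet> h) - t\<^sup>2 * (h \<bullet> (?H *v h)) / 2" for t
    define \<phi>' where "\<phi>' t = grad f (x + t *\<^sub>R h) \<bullet> h - grad f x \<bullet> h - t * (h \<bullet> (?H *v h))" for t
    have "(\<phi> has_real_derivative \<phi>' t) (at t)" for t
      unfolding \<phi>_def \<phi>'_def
      by (auto intro!: derivative_eq_intros has_field_derivative_line C_2_has_derivative_grad[OF f])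
    then obtain z where z: "0 < z" "z < 1" "\<phi> 1 - \<phi> 0 = (1 - 0) * \<phi>' z"
      using MVT2[of 0 1 \<phi> \<phi>'] by auto
    have nz: "norm (z *\<^sub>R h) \<le> norm h"
      using z by (simp add: mult_left_le_one_le)
    have "\<phi>' z = (grad f (x + z *\<^sub>R h) - grad f x - ?H *v (z *\<^sub>R h)) \<bullet> h"
      by (simp add: \<phi>'_def inner_diff_left inner_diff_right inner_commute matrix_vector_mult_scaleR)
    also have "\<bar>\<dots>\<bar> \<le> norm (grad f (x + z *\<^sub>R h) - grad f x - ?H *v (z *\<^sub>R h)) * norm h"
      by (rule Cauchy_Schwarz_ineq2)
    also have "\<dots> \<le> (e * norm h) * norm h"
    proof (rule mult_right_mono)
      have "norm (grad f (x + z *\<^sub>R h) - grad f x - ?H *v (z *\<^sub>R h)) \<le> e * norm (z *\<^sub>R h)"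
        using \<delta>[of "x + z *\<^sub>R h"] nz h by simp
      also have "\<dots> \<le> e * norm h"
        using nz \<open>e > 0\<close> by (intro mult_left_mono) auto
      finally show "norm (grad f (x + z *\<^sub>R h) - grad f x - ?H *v (z *\<^sub>R h)) \<le> e * norm h" .
    qed auto
    finally show ?thesis
      using z by (simp add: \<phi>_def power2_eq_square algebra_simps)
  qed
  then show ?thesis
    using that \<open>\<delta> > 0\<close> by blast
qed

lemma dist_divide_less:
  fixes a b s e :: real
  assumes "s > 0" "\<bar>a - s * b\<bar> < s * e"
  shows "dist (a / s) b < e"
proof -
  have "a / s - b = (a - s * b) / s"
    using \<open>s > 0\<close> by (simp add: diff_divide_distrib)
  with assms show ?thesis
    by (simp add: dist_real_def pos_divide_less_eq mult.commute[of e])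
qed

text \<open>The route to symmetry of the Hessian: the second difference does not change when h and k
  are swapped. One mean value step in direction h leaves a difference of gradients, which the
  derivative of the gradient at x linearizes.\<close>

lemma second_difference_tendsto:
  assumes f: "C_k 2 f"
  shows "((\<lambda>t. (f (x + t *\<^sub>R h + t *\<^sub>R k) - f (x + t *\<^sub>R h) - f (x + t *\<^sub>R k) + f x) / t\<^sup>2)
           \<longlongrightarrow> h \<bullet> (hessian f x *v k)) (at_right 0)"
    (is "((\<lambda>t. ?\<Delta> t / t\<^sup>2) \<longlongrightarrow> ?L) _")
proof (rule tendstoI)
  let ?H = "hessian f x"
  fix \<epsilon> :: real assume "\<epsilon> > 0"
  define N where "N = norm h + norm k + 1"
  have N: "N > 0"
    by (simp add: N_def add_nonneg_pos)
  \<comment> \<open>Two gradient errors of size e t N, each paired with h and scaled by t, then add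
    up to at most t^2 \<epsilon> / 2.\<close>
  define e where "e = \<epsilon> / (4 * N\<^sup>2)"
  have "e > 0"
    using N \<open>\<epsilon> > 0\<close> by (simp add: e_def)
  obtain \<delta> where "\<delta> > 0" and \<delta>: "\<And>y. norm (y - x) < \<delta> \<Longrightarrow>
      norm (grad f y - grad f x - ?H *v (y - x)) \<le> e * norm (y - x)"
    using C_2_has_derivative_hessian[OF f, of x] \<open>e > 0\<close> unfolding has_derivative_at_alt by blast
  have "dist (?\<Delta> t / t\<^sup>2) ?L < \<epsilon>" if t: "0 < t" "t < \<delta> / N" for t
  proof -
    have err: "norm (grad f (x + z) - grad f x - ?H *v z) \<le> e * (t * N)" if "norm z \<le> t * N" for z
    proof -
      have "t * N < \<delta>"
        using t N by (simp add: field_simps)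
      then have "norm (grad f (x + z) - grad f x - ?H *v z) \<le> e * norm z"
        using \<delta>[of "x + z"] that by simp
      also have "\<dots> \<le> e * (t * N)"
        using that \<open>e > 0\<close> by (intro mult_left_mono) auto
      finally show ?thesis .
    qed
    \<comment> \<open>The increment of f under the shift t k, moved along t h:
      \<open>\<phi> 1 - \<phi> 0\<close> is the second difference.\<close>
    define \<phi> where "\<phi> s = f (x + t *\<^sub>R k + s *\<^sub>R (t *\<^sub>R h)) - f (x + s *\<^sub>R (t *\<^sub>R h))" for s
    define \<phi>' where "\<phi>' s = grad f (x + t *\<^sub>R k + s *\<^sub>R (t *\<^sub>R h)) \<bullet> (t *\<^sub>R h)
      - grad f (x + s *\<^sub>R (t *\<^sub>R h)) \<bullet> (t *\<^sub>R h)" for s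
    have "(\<phi> has_real_derivative \<phi>' s) (at s)" for s
      unfolding \<phi>_def \<phi>'_def
      by (intro derivative_intros has_field_derivative_line C_2_has_derivative_grad[OF f])
    then obtain s where s: "0 < s" "s < 1" "\<phi> 1 - \<phi> 0 = (1 - 0) * \<phi>' s"
      using MVT2[of 0 1 \<phi> \<phi>'] by auto
    define a where "a = s *\<^sub>R (t *\<^sub>R h)"
    define b where "b = t *\<^sub>R k + a"
    have na: "norm a \<le> t * norm h"
      using s t by (simp add: a_def mult_left_le_one_le)
    have "norm b \<le> t * norm k + norm a"
      using t norm_triangle_ineq[of "t *\<^sub>R k" a] by (simp add: b_def)
    with na have nb: "norm b \<le> t * N"
      using t by (simp add: N_def algebra_simps)
    have "norm h \<le> N"
      by (simp add: N_def)
    with na have na: "norm a \<le> t * N"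
      using t by (meson less_eq_real_def mult_left_mono order_trans)
    have "?\<Delta> t = \<phi> 1 - \<phi> 0"
      by (simp add: \<phi>_def algebra_simps)
    also have "\<dots> = \<phi>' s"
      using s by simp
    also have "\<dots> = t * ((grad f (x + b) - grad f (x + a)) \<bullet> h)"
      by (simp add: \<phi>'_def a_def b_def inner_diff_left algebra_simps)
    \<comment> \<open>Since b - a = t k, subtracting the two linearizations leaves the main term t^2
      (h \<bullet> H k), and only linearization errors remain.\<close>
    also have "\<dots> = t * (((grad f (x + b) - grad f x - ?H *v b)
        - (grad f (x + a) - grad f x - ?H *v a)) \<bullet> h) + t\<^sup>2 * ?L"
      by (simp add: b_def inner_diff_left inner_diff_right matrix_vector_right_distrib inner_commute[of h]
          inner_add_left matrix_vector_mult_scaleR power2_eq_square algebra_simps)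
    finally have "\<bar>?\<Delta> t - t\<^sup>2 * ?L\<bar> = t * \<bar>((grad f (x + b) - grad f x - ?H *v b)
        - (grad f (x + a) - grad f x - ?H *v a)) \<bullet> h\<bar>"
      using t by (simp add: abs_mult)
    also have "\<dots> \<le> t * ((e * (t * N) + e * (t * N)) * N)"
      using t N \<open>e > 0\<close> \<open>norm h \<le> N\<close> add_mono[OF err[OF nb] err[OF na]]
      by (intro mult_left_mono order_trans[OF Cauchy_Schwarz_ineq2] mult_mono
          order_trans[OF norm_triangle_ineq4]) auto
    also have "\<dots> = t\<^sup>2 * (\<epsilon> / 2)"
      using N by (simp add: e_def power2_eq_square field_simps)
    also have "\<dots> < t\<^sup>2 * \<epsilon>"
      using t \<open>\<epsilon> > 0\<close> by simp
    finally show ?thesis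
      using t by (intro dist_divide_less) auto
  qed
  then show "\<forall>\<^sub>F t in at_right 0. dist (?\<Delta> t / t\<^sup>2) ?L < \<epsilon>"
    using \<open>\<delta> > 0\<close> N by (intro eventually_at_rightI[of 0 "\<delta> / N"]) auto
qed

text \<open>The same symmetric difference quotient converges to both sides, and limits are
  unique.\<close>

lemma hessian_symmetric:
  assumes "C_k 2 f"
  shows "h \<bullet> (hessian f x *v k) = (hessian f x *v h) \<bullet> k"
proof -
  have "((\<lambda>t. (f (x + t *\<^sub>R h + t *\<^sub>R k) - f (x + t *\<^sub>R h) - f (x + t *\<^sub>R k) + f x) / t\<^sup>2)
           \<longlongrightarrow> k \<bullet> (hessian f x *v h)) (at_right 0)"
    using second_difference_tendsto[OF assms, of x k h] by (simp add: algebra_simps)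
  then show ?thesis
    using tendsto_unique[OF _ second_difference_tendsto[OF assms, of x h k]]
    by (simp add: inner_commute trivial_limit_at_right_real)
qed

text \<open>At a critical point only the quadratic term survives on the scale t^2. Applied to V and
  to d(x, .), this yields the second-order condition of player -1.\<close>

lemma second_order_tendsto:
  assumes f: "C_k 2 f" and crit: "grad f x = 0"
  shows "((\<lambda>t. (f (x + t *\<^sub>R h) - f x) / t\<^sup>2) \<longlongrightarrow> h \<bullet> (hessian f x *v h) / 2) (at 0)"
proof (rule tendstoI)
  fix \<epsilon> :: real assume "\<epsilon> > 0"
  define N where "N = norm h + 1"
  have N: "N > 0" "norm h < N"
    by (simp_all add: N_def add_nonneg_pos)
  \<comment> \<open>N strictly exceeds \<open>norm h\<close>, so the Taylor error, at most e t^2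
    |h|^2, stays strictly below t^2 \<epsilon>.\<close>
  define e where "e = \<epsilon> / N\<^sup>2"
  have "e > 0"
    using N \<open>\<epsilon> > 0\<close> by (simp add: e_def)
  obtain \<delta> where "\<delta> > 0" and \<delta>: "\<And>k. norm k < \<delta> \<Longrightarrow>
      \<bar>f (x + k) - f x - grad f x \<bullet> k - k \<bullet> (hessian f x *v k) / 2\<bar> \<le> e * (norm k)\<^sup>2"
    using second_order_Taylor[OF f \<open>e > 0\<close>, where x = x] by metis
  have "dist ((f (x + t *\<^sub>R h) - f x) / t\<^sup>2) (h \<bullet> (hessian f x *v h) / 2) < \<epsilon>"
    if t: "t \<noteq> 0" "dist t 0 < \<delta> / N" for t
  proof -
    have "norm (t *\<^sub>R h) \<le> \<bar>t\<bar> * N"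
      using N by (simp add: mult_left_mono)
    also have "\<dots> < \<delta>"
      using t N by (simp add: field_simps)
    finally have "\<bar>f (x + t *\<^sub>R h) - f x - t\<^sup>2 * (h \<bullet> (hessian f x *v h) / 2)\<bar> \<le> e * (t\<^sup>2 * (norm h)\<^sup>2)"
      using \<delta>[of "t *\<^sub>R h"] crit
      by (simp add: matrix_vector_mult_scaleR power2_eq_square algebra_simps)
    also have "\<dots> = t\<^sup>2 * (e * (norm h)\<^sup>2)"
      by simp
    also have "\<dots> < t\<^sup>2 * \<epsilon>"
    proof -
      have "(norm h)\<^sup>2 < N\<^sup>2"
        using N by (intro power_strict_mono) auto
      then have "e * (norm h)\<^sup>2 < e * N\<^sup>2"
        using \<open>e > 0\<close> by simp
      also have "\<dots> = \<epsilon>"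
        using N by (simp add: e_def)
      finally show ?thesis
        using t by simp
    qed
    finally show ?thesis
      using t by (intro dist_divide_less) auto
  qed
  then show "\<forall>\<^sub>F t in at 0. dist ((f (x + t *\<^sub>R h) - f x) / t\<^sup>2) (h \<bullet> (hessian f x *v h) / 2) < \<epsilon>"
    unfolding eventually_at using \<open>\<delta> > 0\<close> N by (metis divide_pos_pos)
qed

subsection \<open>Spectra of symmetric matrices\<close>

text \<open>Close to 0 a nonzero linear term dominates the quadratic one and would change sign
  there.\<close>

lemma linear_coefficient_zero:
  fixes a b :: real
  assumes "\<And>t. 0 \<le> t * a + t\<^sup>2 * b"
  shows "a = 0"
proof (rule ccontr)
  assume "a \<noteq> 0"
  define s where "s = \<bar>b\<bar> + 1"
  have s: "s > 0" "b < s"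
    by (auto simp: s_def)
  \<comment> \<open>The witness t = -a/s points against the sign of a; it is short enough because s
    exceeds b.\<close>
  have "(- a / s) * a + (- a / s)\<^sup>2 * b = (a / s)\<^sup>2 * (b - s)"
    using s by (simp add: field_simps power2_eq_square)
  also have "\<dots> < 0"
    using s \<open>a \<noteq> 0\<close> by (intro mult_pos_neg) auto
  finally show False
    using assms[of "- a / s"] by simp
qed

section \<open>Rayleigh quotients and orthogonal eigenbases\<close>

lemma subspace_eigenspace: "subspace (eigenspace A l)"
  by (auto simp: subspace_def eigenspace_def matrix_vector_right_distrib matrix_vector_mult_scaleR
      scaleR_add_right mult.commute)

lemma eigenvaluesI:
  assumes "norm v = 1" "v \<in> eigenspace A l"
  shows "l \<in> eigenvalues A"
proof -
  have "v \<noteq> 0"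
    using assms by auto
  with assms show ?thesis
    by (auto simp: eigenvalues_def)
qed

text \<open>Symmetry is phrased as self-adjointness for the inner product, the form in which it was
  obtained for Hessians.\<close>

locale symmetric_matrix =
  fixes A :: "real ^ 'n::finite ^ 'n"
  assumes symmetric: "h \<bullet> (A *v k) = (A *v h) \<bullet> k"
begin

text \<open>The quadratic form attains a minimum l on the compact unit sphere of S. Invariance puts
  the residual r = A z - l z into S, so z may be perturbed along r, and the first-order condition
  forces r = 0.\<close>

lemma Rayleigh_minimizer:
  assumes S: "subspace S" "S \<noteq> {0}" and inv: "\<And>x. x \<in> S \<Longrightarrow> A *v x \<in> S"
  obtains z l where "z \<in> S" "norm z = 1" "z \<in> eigenspace A l"
    "\<And>x. x \<in> S \<Longrightarrow> l * (norm x)\<^sup>2 \<le> x \<bullet> (A *v x)"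
proof -
  obtain s where "s \<in> S" "s \<noteq> 0"
    using S subspace_0 by blast
  then have "s /\<^sub>R norm s \<in> sphere 0 1 \<inter> S"
    using S by (simp add: subspace_scale)
  then have "sphere 0 1 \<inter> S \<noteq> {}"
    by blast
  moreover have "compact (sphere 0 1 \<inter> S)"
    by (intro compact_Int_closed compact_sphere closed_subspace S)
  moreover have "continuous_on (sphere 0 1 \<inter> S) (\<lambda>x. x \<bullet> (A *v x))"
    by (intro continuous_intros linear_continuous_on linear_conv_bounded_linear[THEN iffD1]) auto
  ultimately obtain z where z: "z \<in> sphere 0 1 \<inter> S"
    and min: "\<And>x. x \<in> sphere 0 1 \<inter> S \<Longrightarrow> z \<bullet> (A *v z) \<le> x \<bullet> (A *v x)"
    using continuous_attains_inf[of "sphere 0 1 \<inter> S" "\<lambda>x. x \<bullet> (A *v x)"] by blast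
  define l where "l = z \<bullet> (A *v z)"
  have bound: "l * (norm x)\<^sup>2 \<le> x \<bullet> (A *v x)" if "x \<in> S" for x
  proof (cases "x = 0")
    case False
    then have "l \<le> (x /\<^sub>R norm x) \<bullet> (A *v (x /\<^sub>R norm x))"
      using min[of "x /\<^sub>R norm x"] that S by (simp add: l_def subspace_scale)
    also have "\<dots> = (x \<bullet> (A *v x)) / (norm x)\<^sup>2"
      by (simp add: matrix_vector_mult_scaleR power2_eq_square field_simps)
    finally show ?thesis
      using False by (simp add: field_simps)
  qed simp
  define r where "r = A *v z - l *\<^sub>R z"
  have "r \<in> S"
    using z inv S by (simp add: r_def subspace_diff subspace_scale)
  \<comment> \<open>This polynomial in t is the form minus l times the squared norm, at z + t r; the
    constant term cancels and the linear coefficient is 2 |r|^2.\<close>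
  have "0 \<le> t * (2 * (r \<bullet> r)) + t\<^sup>2 * (r \<bullet> (A *v r) - l * (r \<bullet> r))" for t
  proof -
    have "z + t *\<^sub>R r \<in> S"
      using z \<open>r \<in> S\<close> S by (simp add: subspace_add subspace_scale)
    moreover have "z \<bullet> z = 1"
      using z by (simp add: dot_square_norm)
    moreover have "r \<bullet> (A *v z) = r \<bullet> r + l * (r \<bullet> z)"
      by (subst (3) r_def) (simp add: inner_diff_right)
    moreover have "z \<bullet> (A *v r) = r \<bullet> (A *v z)"
      using symmetric[of z r] by (simp add: inner_commute)
    moreover have "(norm (z + t *\<^sub>R r))\<^sup>2 = z \<bullet> z + 2 * t * (r \<bullet> z) + t\<^sup>2 * (r \<bullet> r)"
      unfolding power2_norm_eq_inner power2_eq_square[of t]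
      by (simp add: inner_add_left inner_add_right inner_commute[of z r] algebra_simps)
    moreover have "(z + t *\<^sub>R r) \<bullet> (A *v (z + t *\<^sub>R r)) =
        l + t * (z \<bullet> (A *v r)) + t * (r \<bullet> (A *v z)) + t\<^sup>2 * (r \<bullet> (A *v r))"
      by (simp add: matrix_vector_right_distrib matrix_vector_mult_scaleR l_def
          inner_add_left inner_add_right power2_eq_square algebra_simps)
    ultimately show ?thesis
      using bound[of "z + t *\<^sub>R r"] by (simp add: algebra_simps)
  qed
  then have "r = 0"
    using linear_coefficient_zero by (metis inner_eq_zero_iff mult_eq_0_iff zero_neq_numeral)
  then show ?thesis
    using that[of z l] z bound by (auto simp: r_def eigenspace_def)
qed

lemma eigenspace_orthogonal:
  assumes "x \<in> eigenspace A l" "y \<in> eigenspace A m" "l \<noteq> m"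
  shows "orthogonal x y"
  using symmetric[of x y] assms by (simp add: eigenspace_def orthogonal_def)

lemma eigenvalue_Rayleigh:
  assumes "x \<in> eigenspace A l"
  shows "x \<bullet> (A *v x) = l * (norm x)\<^sup>2"
  using assms by (simp add: eigenspace_def power2_norm_eq_inner)

text \<open>The spectral theorem in counting form. Orthonormal bases of the eigenspaces unite to an
  orthonormal set U, which spans everything because the orthogonal complement of U is invariant and
  would otherwise contain a further eigenvector.\<close>

lemma finite_eigenvalues: "finite (eigenvalues A)"
  and sum_dim_eigenspaces: "(\<Sum>l\<in>eigenvalues A. dim (eigenspace A l)) = CARD('n)"
proof -
  have "\<exists>B. B \<subseteq> eigenspace A l \<and> pairwise orthogonal B \<and> (\<forall>x\<in>B. norm x = 1) \<and>
      card B = dim (eigenspace A l) \<and> span B = eigenspace A l" for l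
    using orthonormal_basis_subspace[OF subspace_eigenspace[of A l]] by metis
  then obtain B where sub: "\<And>l. B l \<subseteq> eigenspace A l"
    and orth: "\<And>l. pairwise orthogonal (B l)"
    and unit: "\<And>l x. x \<in> B l \<Longrightarrow> norm x = 1"
    and card: "\<And>l. card (B l) = dim (eigenspace A l)"
    and span: "\<And>l. span (B l) = eigenspace A l"
    by metis
  define U where "U = (\<Union>l\<in>eigenvalues A. B l)"
  have "pairwise orthogonal U"
    unfolding pairwise_def
  proof clarify
    fix x y assume xy: "x \<in> U" "y \<in> U" "x \<noteq> y"
    then obtain l m where lm: "x \<in> B l" "y \<in> B m"
      by (auto simp: U_def)
    show "orthogonal x y"
    proof (cases "l = m")
      case True
      with orth[of l] lm xy show ?thesis
        by (auto simp: pairwise_def)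
    next
      case False
      then show ?thesis
        using eigenspace_orthogonal lm sub by blast
    qed
  qed
  moreover have "0 \<notin> U"
    using unit by (force simp: U_def)
  ultimately have indep: "independent U"
    by (rule pairwise_orthogonal_independent)
  then have fin: "finite U"
    by (rule independent_imp_finite)
  have full: "span U = UNIV"
  proof (rule ccontr)
    assume "span U \<noteq> UNIV"
    define T where "T = {y. \<forall>u\<in>U. u \<bullet> y = 0}"
    have T: "subspace T"
      by (auto simp: T_def subspace_def inner_add_right)
    obtain y where "y \<noteq> 0" "\<And>x. x \<in> span U \<Longrightarrow> orthogonal y x"
      using \<open>span U \<noteq> UNIV\<close> orthogonal_to_subspace_exists_gen[of U UNIV] by auto
    then have "y \<in> T"
      by (auto simp: T_def orthogonal_def inner_commute span_base)
    with \<open>y \<noteq> 0\<close> have "T \<noteq> {0}"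
      by auto
    have "A *v y \<in> T" if "y \<in> T" for y
    proof -
      have "u \<bullet> (A *v y) = 0" if "u \<in> U" for u
      proof -
        obtain l where "A *v u = l *\<^sub>R u"
          using \<open>u \<in> U\<close> sub by (fastforce simp: U_def eigenspace_def)
        with \<open>y \<in> T\<close> \<open>u \<in> U\<close> show ?thesis
          by (simp add: symmetric T_def)
      qed
      then show ?thesis
        by (simp add: T_def)
    qed
    \<comment> \<open>The eigenspace of z is already spanned by part of U, so z lies in the span of
      U and is orthogonal to U at once.\<close>
    then obtain z l where z: "z \<in> T" "norm z = 1" "z \<in> eigenspace A l"
      using Rayleigh_minimizer[OF T \<open>T \<noteq> {0}\<close>] by metis
    then have "z \<noteq> 0"
      by auto
    with z have "B l \<subseteq> U"
      by (auto simp: U_def eigenvalues_def)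
    then have "z \<in> span U"
      using z span span_mono by blast
    moreover have "orthogonal z u" if "u \<in> U" for u
      using z that by (auto simp: T_def orthogonal_def inner_commute)
    ultimately have "orthogonal z z"
      using orthogonal_to_span by blast
    with \<open>z \<noteq> 0\<close> show False
      by (simp add: orthogonal_self)
  qed
  \<comment> \<open>Every eigenvalue is the Rayleigh quotient of some vector in the finite set U,
    hence there are finitely many.\<close>
  have "l \<in> (\<lambda>u. u \<bullet> (A *v u)) ` U" if l: "l \<in> eigenvalues A" for l
  proof -
    have "B l \<noteq> {}"
      using l span[of l] by (auto simp: eigenvalues_def)
    then obtain u where "u \<in> B l"
      by auto
    moreover from this have "u \<bullet> (A *v u) = l"
      using eigenvalue_Rayleigh sub unit by fastforce
    ultimately show ?thesis
      using l by (force simp: U_def)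
  qed
  then have "eigenvalues A \<subseteq> (\<lambda>u. u \<bullet> (A *v u)) ` U"
    by (rule subsetI)
  then show fin_ev: "finite (eigenvalues A)"
    by (rule finite_surj[OF fin])
  have "card U = (\<Sum>l\<in>eigenvalues A. card (B l))"
    unfolding U_def
  proof (rule card_UN_disjoint[OF fin_ev])
    show "\<forall>l\<in>eigenvalues A. finite (B l)"
      using fin by (auto simp: U_def intro: finite_subset)
    show "\<forall>l\<in>eigenvalues A. \<forall>m\<in>eigenvalues A. l \<noteq> m \<longrightarrow> B l \<inter> B m = {}"
    proof (intro ballI impI equals0I)
      fix l m x assume "l \<noteq> m" "x \<in> B l \<inter> B m"
      then have "orthogonal x x"
        using eigenspace_orthogonal sub by blast
      moreover have "norm x = 1"
        using \<open>x \<in> B l \<inter> B m\<close> unit by blast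
      ultimately show False
        by (simp add: orthogonal_def dot_square_norm)
    qed
  qed
  moreover have "card U = CARD('n)"
    using indep full dim_eq_card[of U UNIV] by simp
  ultimately show "(\<Sum>l\<in>eigenvalues A. dim (eigenspace A l)) = CARD('n)"
    by (simp add: card)
qed

section \<open>The ordered list of eigenvalues\<close>

lemma eigenvalues_nonempty: "eigenvalues A \<noteq> {}"
  using sum_dim_eigenspaces by force

lemma dim_eigenspace_pos: "l \<in> eigenvalues A \<Longrightarrow> dim (eigenspace A l) > 0"
  by (auto simp: eigenvalues_def intro!: Nat.gr0I)

lemma set_eigenvalue_list: "set (eigenvalue_list A) = eigenvalues A"
  using finite_eigenvalues dim_eigenspace_pos by (fastforce simp: eigenvalue_list_def simp del: dim_eq_0)

lemma length_eigenvalue_list: "length (eigenvalue_list A) = CARD('n)"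
proof -
  have "length (eigenvalue_list A) =
      sum_list (map (\<lambda>l. dim (eigenspace A l)) (sorted_list_of_set (eigenvalues A)))"
    by (simp add: eigenvalue_list_def length_concat comp_def)
  also have "\<dots> = CARD('n)"
    using finite_eigenvalues sum_dim_eigenspaces by (simp add: sum_list_distinct_conv_sum_set)
  finally show ?thesis .
qed

lemma lambda_min_eigenvalue: "lambda_min A \<in> eigenvalues A"
  unfolding lambda_min_def using finite_eigenvalues eigenvalues_nonempty by (rule Min_in)

text \<open>The list opens with a block of copies of the smallest eigenvalue, as long as its
  multiplicity. Position 0 identifies the first eigenvalue; position 1 detects a multiple
  one.\<close>

lemma eigenvalue_list_nth_lambda_min:
  assumes "i < dim (eigenspace A (lambda_min A))"
  shows "eigenvalue_list A ! i = lambda_min A"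
proof -
  have "sorted_list_of_set (eigenvalues A) =
      lambda_min A # sorted_list_of_set (eigenvalues A - {lambda_min A})"
    unfolding lambda_min_def
    using finite_eigenvalues eigenvalues_nonempty by (rule sorted_list_of_set_nonempty)
  then show ?thesis
    using assms by (simp add: eigenvalue_list_def nth_append)
qed

text \<open>The complement of v is invariant, so the minimum of the Rayleigh quotient on it is an
  eigenvalue. It differs from the smallest one, hence sits at a positive position of the list and
  can serve as c.\<close>

lemma orthogonal_form_positive:
  assumes v: "norm v = 1" "v \<in> eigenspace A (lambda_min A)"
    and neg: "lambda_min A < 0"
    and pos: "\<And>i. \<lbrakk>0 < i; i < CARD('n)\<rbrakk> \<Longrightarrow> 0 < eigenvalue_list A ! i"
  obtains c where "c > 0" "\<And>w. v \<bullet> w = 0 \<Longrightarrow> c * (norm w)\<^sup>2 \<le> w \<bullet> (A *v w)"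
\<comment> \<open>In dimension one the complement is trivial and any positive constant
  works.\<close>
proof (cases "{w. v \<bullet> w = 0} = {0}")
  case True
  then show ?thesis
    using that[of 1] by (auto simp: set_eq_iff)
next
  case False
  have S: "subspace {w. v \<bullet> w = 0}"
    by (auto simp: subspace_def inner_add_right)
  have inv: "A *v w \<in> {w. v \<bullet> w = 0}" if "w \<in> {w. v \<bullet> w = 0}" for w
    using v that by (simp add: symmetric eigenspace_def)
  obtain z l where z: "v \<bullet> z = 0" "norm z = 1" "z \<in> eigenspace A l"
    and l: "\<And>w. v \<bullet> w = 0 \<Longrightarrow> l * (norm w)\<^sup>2 \<le> w \<bullet> (A *v w)"
    by (rule Rayleigh_minimizer[OF S False inv]) auto
  have ev: "l \<in> eigenvalues A"
    using z by (blast intro: eigenvaluesI)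
  \<comment> \<open>Otherwise v and z would span a plane of eigenvectors, and position 1 of the
    list, the second eigenvalue, would be negative.\<close>
  have "l \<noteq> lambda_min A"
  proof
    assume "l = lambda_min A"
    then have "{v, z} \<subseteq> eigenspace A (lambda_min A)"
      using v z by auto
    moreover have "independent {v, z}"
      using v z by (intro pairwise_orthogonal_independent)
        (auto simp: pairwise_insert orthogonal_def inner_commute)
    ultimately have "card {v, z} \<le> dim (eigenspace A (lambda_min A))"
      by (metis dim_eq_card_independent dim_subset)
    moreover have "v \<noteq> z"
      using z by auto
    ultimately have two: "1 < dim (eigenspace A (lambda_min A))"
      by simp
    also have "\<dots> \<le> CARD('n)"
      using dim_subset_UNIV_cart by blast
    finally show False
      using pos[of 1] neg eigenvalue_list_nth_lambda_min[OF two] by simp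
  qed
  moreover obtain i where "i < CARD('n)" "eigenvalue_list A ! i = l"
    using ev set_eigenvalue_list length_eigenvalue_list by (metis in_set_conv_nth)
  moreover have "eigenvalue_list A ! 0 = lambda_min A"
    using eigenvalue_list_nth_lambda_min dim_eigenspace_pos lambda_min_eigenvalue by blast
  ultimately have "l > 0"
    using pos[of i] by (cases i) auto
  then show ?thesis
    using that l by blast
qed

text \<open>The cross terms vanish: A v is a multiple of v, and h minus its projection is orthogonal
  to v.\<close>

lemma quadratic_form_split:
  assumes v: "norm v = 1" "v \<in> eigenspace A l"
  shows "h \<bullet> (A *v h) = l * (v \<bullet> h)\<^sup>2 + (h - proj v h) \<bullet> (A *v (h - proj v h))"
proof -
  have "v \<bullet> (A *v h) = l * (v \<bullet> h)"
    using v by (simp add: symmetric eigenspace_def)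
  moreover have "h \<bullet> (A *v v) = l * (v \<bullet> h)" "v \<bullet> (A *v v) = l"
    using v by (simp_all add: eigenspace_def inner_commute dot_square_norm)
  ultimately show ?thesis
    by (simp add: proj_def matrix_vector_mult_diff_distrib matrix_vector_mult_scaleR inner_diff_left
        inner_diff_right power2_eq_square)
qed

lemma quadratic_form_proj:
  assumes "norm v = 1" "v \<in> eigenspace A l"
  shows "proj v h \<bullet> (A *v proj v h) = l * (v \<bullet> h)\<^sup>2"
  using assms by (simp add: proj_def matrix_vector_mult_scaleR eigenspace_def dot_square_norm
      power2_eq_square)

end

section \<open>Orthogonal projection onto a unit vector\<close>

lemma inner_diff_proj: "norm v = 1 \<Longrightarrow> v \<bullet> (h - proj v h) = 0"
  by (simp add: proj_def inner_diff_right dot_square_norm)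

lemma norm_proj_split: "norm v = 1 \<Longrightarrow> (norm h)\<^sup>2 = (v \<bullet> h)\<^sup>2 + (norm (h - proj v h))\<^sup>2"
  by (simp add: proj_def power2_norm_eq_inner norm_eq_1 inner_diff_left inner_diff_right
      inner_commute[of h v] power2_eq_square[of "v \<bullet> h"])

lemma norm_proj_le: "norm v = 1 \<Longrightarrow> norm (proj v h) \<le> norm h"
  using Cauchy_Schwarz_ineq2[of v h] by (simp add: proj_def)

lemma norm_diff_proj_le:
  assumes "norm v = 1"
  shows "norm (h - proj v h) \<le> norm h"
proof (rule power2_le_imp_le)
  show "(norm (h - proj v h))\<^sup>2 \<le> (norm h)\<^sup>2"
    using norm_proj_split[OF assms, of h] zero_le_power2[of "v \<bullet> h"] by linarith
qed simp

subsection \<open>Strict equilibria and index-1 saddles\<close>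

text \<open>A convex function that vanishes at x grows along each ray from x at least at the slope
  reached on the sphere of radius \<epsilon>. By compactness and positivity off x, the minimum on
  that sphere, divided by \<epsilon>, is a common positive slope.\<close>

lemma proximal_linear_growth:
  assumes d: "proximal_function d" and "\<epsilon> > 0"
  obtains m where "m > 0" "\<And>y. \<epsilon> \<le> norm (y - x) \<Longrightarrow> m * norm (y - x) \<le> d x y"
proof -
  have C2: "C_k 2 (d x)" and conv: "convex_on UNIV (d x)" and zero: "d x x = 0"
    and pos: "\<And>y. y \<noteq> x \<Longrightarrow> 0 < d x y"
    using d by (auto simp: proximal_function_def less_le)
  have "continuous_on (sphere x \<epsilon>) (d x)"
    by (intro continuous_at_imp_continuous_on ballI
        has_derivative_continuous[OF C_2_has_derivative_grad[OF C2]])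
  moreover have "sphere x \<epsilon> \<noteq> {}"
    using \<open>\<epsilon> > 0\<close> by simp
  ultimately obtain s where s: "s \<in> sphere x \<epsilon>" "\<And>y. y \<in> sphere x \<epsilon> \<Longrightarrow> d x s \<le> d x y"
    using continuous_attains_inf[of "sphere x \<epsilon>" "d x"] by auto
  have "s \<noteq> x"
    using s \<open>\<epsilon> > 0\<close> by auto
  have "d x s / \<epsilon> * norm (y - x) \<le> d x y" if y: "\<epsilon> \<le> norm (y - x)" for y
  proof -
    define r where "r = norm (y - x)"
    \<comment> \<open>The point where the segment from x to y meets the sphere.\<close>
    define p where "p = (1 - \<epsilon> / r) *\<^sub>R x + (\<epsilon> / r) *\<^sub>R y"
    have r: "r > 0" "\<epsilon> \<le> r"
      using y \<open>\<epsilon> > 0\<close> by (auto simp: r_def)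
    have "p - x = (\<epsilon> / r) *\<^sub>R (y - x)"
      by (simp add: p_def algebra_simps)
    then have "norm (p - x) = \<epsilon>"
      using r \<open>\<epsilon> > 0\<close> by (simp add: r_def)
    then have "d x s \<le> d x p"
      using s by (simp add: dist_norm norm_minus_commute)
    also have "\<dots> \<le> (1 - \<epsilon> / r) * d x x + \<epsilon> / r * d x y"
      unfolding p_def using r \<open>\<epsilon> > 0\<close> by (intro convex_onD[OF conv]) auto
    finally show ?thesis
      using r \<open>\<epsilon> > 0\<close> by (simp add: zero field_simps flip: r_def)
  qed
  then show ?thesis
    using that[of "d x s / \<epsilon>"] pos[OF \<open>s \<noteq> x\<close>] \<open>\<epsilon> > 0\<close> by simp
qed

section \<open>The auxiliary function W near and far from its base point\<close>

lemma W_displacement: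
  "W \<alpha> \<beta> V (x + h) x v = (1 - \<alpha>) * V (x + h) + \<alpha> * V (x + (h - proj v h)) - \<beta> * V (x + proj v h)"
  by (simp add: W_def add_diff_eq)

text \<open>Left uncollected so that it subtracts term by term from the displaced value.\<close>

lemma W_base: "W \<alpha> \<beta> V x x v = (1 - \<alpha>) * V x + \<alpha> * V x - \<beta> * V x"
  by (simp add: W_def proj_def)

text \<open>The weights are those of W; the bound serves both the Lipschitz estimate and the Taylor
  errors.\<close>

lemma abs_weighted_le:
  fixes a b c :: real
  assumes "\<bar>a\<bar> \<le> M" "\<bar>b\<bar> \<le> M" "\<bar>c\<bar> \<le> M"
  shows "\<bar>(1 - \<alpha>) * a + \<alpha> * b - \<beta> * c\<bar> \<le> (\<bar>1 - \<alpha>\<bar> + \<bar>\<alpha>\<bar> + \<bar>\<beta>\<bar>) * M"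
proof -
  have "\<bar>(1 - \<alpha>) * a + \<alpha> * b - \<beta> * c\<bar> \<le> \<bar>(1 - \<alpha>) * a\<bar> + \<bar>\<alpha> * b\<bar> + \<bar>\<beta> * c\<bar>"
    by linarith
  also have "\<dots> \<le> \<bar>1 - \<alpha>\<bar> * M + \<bar>\<alpha>\<bar> * M + \<bar>\<beta>\<bar> * M"
    unfolding abs_mult using assms by (intro add_mono mult_left_mono) auto
  finally show ?thesis
    by (simp add: algebra_simps)
qed

text \<open>Neither projection lengthens h, so each of the three values of V moves by at most L
  |h|.\<close>

lemma W_Lipschitz:
  assumes V: "L-lipschitz_on UNIV V" and v: "norm v = 1"
  shows "\<bar>W \<alpha> \<beta> V (x + h) x v - W \<alpha> \<beta> V x x v\<bar> \<le> (\<bar>1 - \<alpha>\<bar> + \<bar>\<alpha>\<bar> + \<bar>\<beta>\<bar>) * (L * norm h)"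
proof -
  have "L \<ge> 0"
    using V by (rule lipschitz_on_nonneg)
  have bound: "\<bar>V (x + k) - V x\<bar> \<le> L * norm h" if "norm k \<le> norm h" for k
  proof -
    have "\<bar>V (x + k) - V x\<bar> \<le> L * norm k"
      using lipschitz_onD[OF V, of "x + k" x] by (simp add: dist_norm)
    also have "\<dots> \<le> L * norm h"
      using that \<open>L \<ge> 0\<close> by (rule mult_left_mono)
    finally show ?thesis .
  qed
  have "W \<alpha> \<beta> V (x + h) x v - W \<alpha> \<beta> V x x v = (1 - \<alpha>) * (V (x + h) - V x)
      + \<alpha> * (V (x + (h - proj v h)) - V x) - \<beta> * (V (x + proj v h) - V x)"
    unfolding W_displacement W_base by (simp add: algebra_simps)
  then show ?thesis
    using norm_proj_le[OF v] norm_diff_proj_le[OF v] by (simp only:) (intro abs_weighted_le bound; simp)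
qed

text \<open>Expanding the three values of V leaves a quadratic form with positive coefficient (1 -
  \<alpha> - \<beta>) l along v and lower bound c across it; this beats the Taylor errors near
  x.\<close>

lemma W_strict_local_min:
  assumes V: "C_k 2 V" and crit: "grad V x = 0"
    and v: "norm v = 1" "v \<in> eigenspace (hessian V x) l" and "l < 0"
    and "c > 0" and pos: "\<And>w. v \<bullet> w = 0 \<Longrightarrow> c * (norm w)\<^sup>2 \<le> w \<bullet> (hessian V x *v w)"
    and "\<alpha> + \<beta> > 1"
  obtains \<epsilon> where "\<epsilon> > 0"
    "\<And>h. \<lbrakk>h \<noteq> 0; norm h < \<epsilon>\<rbrakk> \<Longrightarrow> W \<alpha> \<beta> V x x v < W \<alpha> \<beta> V (x + h) x v"
proof -
  interpret symmetric_matrix "hessian V x"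
    by unfold_locales (rule hessian_symmetric[OF V])
  define q where "q h = h \<bullet> (hessian V x *v h) / 2" for h
  define K where "K = \<bar>1 - \<alpha>\<bar> + \<bar>\<alpha>\<bar> + \<bar>\<beta>\<bar> + 1"
  have "K > 0"
    by (simp add: K_def add_nonneg_pos)
  define c' where "c' = min ((1 - \<alpha> - \<beta>) * l) c"
  have "c' > 0"
    using \<open>l < 0\<close> \<open>\<alpha> + \<beta> > 1\<close> \<open>c > 0\<close> by (simp add: c'_def mult_neg_neg)
  \<comment> \<open>The weighted Taylor errors then total at most c' |h|^2 / 4, half of the
    guaranteed quadratic gain c' |h|^2 / 2.\<close>
  define e where "e = c' / (4 * K)"
  have "e > 0"
    using \<open>c' > 0\<close> \<open>K > 0\<close> by (simp add: e_def)
  obtain \<epsilon> where "\<epsilon> > 0" and \<epsilon>: "\<And>h. norm h < \<epsilon> \<Longrightarrow>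
      \<bar>V (x + h) - V x - grad V x \<bullet> h - h \<bullet> (hessian V x *v h) / 2\<bar> \<le> e * (norm h)\<^sup>2"
    using second_order_Taylor[OF V \<open>e > 0\<close>, where x = x] by metis
  have "W \<alpha> \<beta> V x x v < W \<alpha> \<beta> V (x + h) x v" if h: "h \<noteq> 0" "norm h < \<epsilon>" for h
  proof -
    let ?w = "h - proj v h" and ?p = "proj v h"
    define E where "E k = V (x + k) - V x - q k" for k
    have E: "\<bar>E k\<bar> \<le> e * (norm h)\<^sup>2" if "norm k \<le> norm h" for k
    proof -
      have "\<bar>E k\<bar> \<le> e * (norm k)\<^sup>2"
        using \<epsilon>[of k] that h crit by (simp add: E_def q_def)
      also have "\<dots> \<le> e * (norm h)\<^sup>2"
        using that \<open>e > 0\<close> by (intro mult_left_mono power_mono) auto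
      finally show ?thesis .
    qed
    have "\<bar>(1 - \<alpha>) * E h + \<alpha> * E ?w - \<beta> * E ?p\<bar> \<le> (\<bar>1 - \<alpha>\<bar> + \<bar>\<alpha>\<bar> + \<bar>\<beta>\<bar>) * (e * (norm h)\<^sup>2)"
      using norm_proj_le[OF v(1)] norm_diff_proj_le[OF v(1)] by (intro abs_weighted_le E) auto
    also have "\<dots> \<le> K * (e * (norm h)\<^sup>2)"
      using \<open>e > 0\<close> by (intro mult_right_mono) (auto simp: K_def)
    also have "\<dots> = c' * (norm h)\<^sup>2 / 4"
      using \<open>K > 0\<close> by (simp add: e_def)
    finally have err: "\<bar>(1 - \<alpha>) * E h + \<alpha> * E ?w - \<beta> * E ?p\<bar> \<le> c' * (norm h)\<^sup>2 / 4" .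
    have "c' * (norm h)\<^sup>2 = c' * (v \<bullet> h)\<^sup>2 + c' * (norm ?w)\<^sup>2"
      using norm_proj_split[OF v(1), of h] by (simp add: distrib_left)
    also have "\<dots> \<le> (1 - \<alpha> - \<beta>) * l * (v \<bullet> h)\<^sup>2 + c * (norm ?w)\<^sup>2"
      by (intro add_mono mult_right_mono) (auto simp: c'_def)
    also have "\<dots> \<le> (1 - \<alpha> - \<beta>) * l * (v \<bullet> h)\<^sup>2 + ?w \<bullet> (hessian V x *v ?w)"
      using pos inner_diff_proj[OF v(1)] by simp
    \<comment> \<open>The part across v carries the weight (1 - \<alpha>) + \<alpha> = 1, the part
      along v the weight (1 - \<alpha>) - \<beta>.\<close>
    also have "\<dots> = 2 * ((1 - \<alpha>) * q h + \<alpha> * q ?w - \<beta> * q ?p)"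
      unfolding q_def quadratic_form_split[OF v, of h] quadratic_form_proj[OF v, of h]
      by (simp add: field_simps)
    finally have "c' * (norm h)\<^sup>2 \<le> 2 * ((1 - \<alpha>) * q h + \<alpha> * q ?w - \<beta> * q ?p)" .
    moreover have "0 < c' * (norm h)\<^sup>2"
      using h \<open>c' > 0\<close> by simp
    moreover have "W \<alpha> \<beta> V (x + h) x v - W \<alpha> \<beta> V x x v = ((1 - \<alpha>) * q h + \<alpha> * q ?w - \<beta> * q ?p)
        + ((1 - \<alpha>) * E h + \<alpha> * E ?w - \<beta> * E ?p)"
      unfolding W_displacement W_base E_def by (simp add: algebra_simps)
    moreover have "a < b" if "s \<le> 2 * q" "0 < s" "b - a = q + r" "\<bar>r\<bar> \<le> s / 4" for a b q r s :: real
      using that by linarith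
    ultimately show ?thesis
      using err by blast
  qed
  with \<open>\<epsilon> > 0\<close> show ?thesis
    using that by blast
qed

text \<open>A unit vector other than v and -v has a nonzero part across v, on which the form exceeds
  l times the squared norm.\<close>

lemma (in symmetric_matrix) Rayleigh_strict_min:
  assumes v: "norm v = 1" "v \<in> eigenspace A l"
    and pos: "\<And>w. v \<bullet> w = 0 \<Longrightarrow> c * (norm w)\<^sup>2 \<le> w \<bullet> (A *v w)"
    and "l < c" and u: "norm u = 1" "u \<noteq> v" "u \<noteq> - v"
  shows "v \<bullet> (A *v v) < u \<bullet> (A *v u)"
proof -
  let ?w = "u - proj v u"
  have "?w \<noteq> 0"
  proof
    assume "?w = 0"
    then have u_eq: "u = (v \<bullet> u) *\<^sub>R v"
      by (simp add: proj_def)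
    then have "norm u = \<bar>v \<bullet> u\<bar>"
      using v by (metis norm_scaleR mult.right_neutral)
    with u(1) have "v \<bullet> u = 1 \<or> v \<bullet> u = -1"
      by linarith
    with u_eq u show False
      by (metis scaleR_one scaleR_minus1_left)
  qed
  then have "l * (norm ?w)\<^sup>2 < c * (norm ?w)\<^sup>2"
    using \<open>l < c\<close> by simp
  also have "\<dots> \<le> ?w \<bullet> (A *v ?w)"
    using pos inner_diff_proj[OF v(1)] by blast
  finally have "l * ((v \<bullet> u)\<^sup>2 + (norm ?w)\<^sup>2) < u \<bullet> (A *v u)"
    using quadratic_form_split[OF v, of u] by (simp add: distrib_left)
  then show ?thesis
    using norm_proj_split[OF v(1), of u] eigenvalue_Rayleigh[OF v(2)] v u by simp
qed

section \<open>Spectral data at a saddle\<close>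

lemma eigval_1:
  assumes "C_k 2 V"
  shows "eigval 1 V x = lambda_min (hessian V x)"
proof -
  interpret symmetric_matrix "hessian V x"
    by unfold_locales (rule hessian_symmetric[OF assms])
  show ?thesis
    using eigenvalue_list_nth_lambda_min[of 0] dim_eigenspace_pos[OF lambda_min_eigenvalue]
    by (simp add: eigval_def)
qed

lemma saddle_positive_complement:
  assumes V: "C_k 2 V" and saddle: "index1_saddle V x" and v: "is_v1 V x v"
  obtains c where "c > 0" "\<And>w. v \<bullet> w = 0 \<Longrightarrow> c * (norm w)\<^sup>2 \<le> w \<bullet> (hessian V x *v w)"
proof -
  interpret symmetric_matrix "hessian V x"
    by unfold_locales (rule hessian_symmetric[OF V])
  have "0 < eigenvalue_list (hessian V x) ! i" if "0 < i" "i < CARD('a)" for i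
  proof -
    \<comment> \<open>List positions count from 0, eigenvalue numbers from 1.\<close>
    have "Suc i \<in> {2..CARD('a)}"
      using that by auto
    then have "0 < eigval (Suc i) V x"
      using saddle unfolding index1_saddle_def by blast
    then show ?thesis
      by (simp add: eigval_def)
  qed
  with orthogonal_form_positive[of v] v saddle that show ?thesis
    unfolding is_v1_def index1_saddle_def eigval_1[OF V] by metis
qed

text \<open>Both vectors have the same Rayleigh quotient, which strict minimality allows only up to
  sign. Each saddle thus contributes at most two equilibrium candidates.\<close>

lemma is_v1_unique:
  assumes V: "C_k 2 V" and saddle: "index1_saddle V x" and v: "is_v1 V x v" "is_v1 V x u"
  shows "u = v \<or> u = - v"
proof -
  interpret symmetric_matrix "hessian V x"
    by unfold_locales (rule hessian_symmetric[OF V])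
  obtain c where "c > 0" "\<And>w. v \<bullet> w = 0 \<Longrightarrow> c * (norm w)\<^sup>2 \<le> w \<bullet> (hessian V x *v w)"
    using saddle_positive_complement[OF V saddle v(1)] by blast
  moreover have "eigval 1 V x < 0"
    using saddle by (simp add: index1_saddle_def)
  ultimately show ?thesis
    using Rayleigh_strict_min[of v "eigval 1 V x" c u] v eigenvalue_Rayleigh
    unfolding is_v1_def by fastforce
qed

text \<open>Stated for all large \<rho> so that the thresholds of finitely many saddles can be
  merged. In the ball where W has its strict minimum a nonnegative penalty does no harm; outside,
  its linear growth beats the decrease of W.\<close>

lemma saddle_imp_strict_nash_equilibrium:
  assumes V: "C_k 2 V" and Lip: "L-lipschitz_on UNIV V" and d: "proximal_function d"
    and "\<alpha> + \<beta> > 1" and saddle: "index1_saddle V x" and v: "is_v1 V x v"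
  shows "\<forall>\<^sub>F \<rho> in at_top. strict_nash_equilibrium \<alpha> \<beta> \<rho> V d x x v"
proof -
  interpret symmetric_matrix "hessian V x"
    by unfold_locales (rule hessian_symmetric[OF V])
  define l where "l = eigval 1 V x"
  have unit: "norm v = 1" and ev: "v \<in> eigenspace (hessian V x) l"
    using v by (auto simp: is_v1_def l_def)
  have "l < 0" "grad V x = 0"
    using saddle by (auto simp: index1_saddle_def l_def)
  obtain c where "c > 0" and c: "\<And>w. v \<bullet> w = 0 \<Longrightarrow> c * (norm w)\<^sup>2 \<le> w \<bullet> (hessian V x *v w)"
    using saddle_positive_complement[OF V saddle v] by blast
  obtain \<epsilon> where "\<epsilon> > 0"
    and \<epsilon>: "\<And>h. \<lbrakk>h \<noteq> 0; norm h < \<epsilon>\<rbrakk> \<Longrightarrow> W \<alpha> \<beta> V x x v < W \<alpha> \<beta> V (x + h) x v"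
    using W_strict_local_min[OF V \<open>grad V x = 0\<close> unit ev \<open>l < 0\<close> \<open>c > 0\<close> c \<open>\<alpha> + \<beta> > 1\<close>] by blast
  obtain m where "m > 0" and m: "\<And>y. \<epsilon> \<le> norm (y - x) \<Longrightarrow> m * norm (y - x) \<le> d x y"
    using proximal_linear_growth[OF d \<open>\<epsilon> > 0\<close>] by blast
  have d_nonneg: "0 \<le> d x y" and d_zero: "d x x = 0" for y
    using d by (auto simp: proximal_function_def)
  define K where "K = (\<bar>1 - \<alpha>\<bar> + \<bar>\<alpha>\<bar> + \<bar>\<beta>\<bar>) * L"
  \<comment> \<open>At distance r \<ge> \<epsilon> from x, W drops by at most K r while the penalty
    is at least \<rho> m r; hence the threshold K / m.\<close>
  have "strict_nash_equilibrium \<alpha> \<beta> \<rho> V d x x v" if \<rho>: "0 < \<rho>" "K / m < \<rho>" for \<rho>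
  proof -
    have y: "cost_y \<alpha> \<beta> \<rho> V d x x v < cost_y \<alpha> \<beta> \<rho> V d y x v" if "y \<noteq> x" for y
    proof -
      define h where "h = y - x"
      have h: "h \<noteq> 0" "y = x + h"
        using that by (auto simp: h_def)
      have "W \<alpha> \<beta> V x x v < W \<alpha> \<beta> V (x + h) x v + \<rho> * d x (x + h)"
      proof (cases "norm h < \<epsilon>")
        case True
        then show ?thesis
          using \<epsilon>[OF h(1)] \<rho> d_nonneg[of "x + h"]
          by (meson add_increasing2 less_le_trans mult_nonneg_nonneg less_imp_le order_refl)
      next
        case False
        have "\<bar>W \<alpha> \<beta> V (x + h) x v - W \<alpha> \<beta> V x x v\<bar> \<le> K * norm h"
          using W_Lipschitz[OF Lip unit, of \<alpha> \<beta> x h] by (simp add: K_def mult.assoc)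
        also have "\<dots> < \<rho> * m * norm h"
          using \<rho> \<open>m > 0\<close> h by (simp add: field_simps)
        also have "\<dots> \<le> \<rho> * d x (x + h)"
          using \<rho> m[of "x + h"] False by (simp add: mult.assoc)
        finally show ?thesis
          by linarith
      qed
      then show ?thesis
        using h by (simp add: cost_y_def d_zero)
    qed
    have u: "cost_u V x x v < cost_u V x x u" if "norm u = 1" "u \<noteq> v" "u \<noteq> - v" for u
      using Rayleigh_strict_min[OF unit ev c _ that] \<open>l < 0\<close> \<open>c > 0\<close> by (simp add: cost_u_def)
    \<comment> \<open>The weak inequality must also cover -v, where the costs are equal.\<close>
    have "cost_u V x x v \<le> cost_u V x x u" if "norm u = 1" for u
    proof (cases "u = v \<or> u = - v")
      case True
      then show ?thesis
        by (auto simp: cost_u_def linear_neg[OF matrix_vector_mul_linear])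
    next
      case False
      then show ?thesis
        using u[OF that] by auto
    qed
    moreover have "cost_y \<alpha> \<beta> \<rho> V d x x v \<le> cost_y \<alpha> \<beta> \<rho> V d y x v" for y
      using y[of y] by (cases "y = x") auto
    ultimately show ?thesis
      unfolding strict_nash_equilibrium_def nash_equilibrium_def
      using y u unit by (auto simp: cost_x_def)
  qed
  then show ?thesis
    by (intro eventually_mono[OF eventually_gt_at_top[of "max 0 (K / m)"]]) simp
qed

text \<open>The penalty has zero gradient and zero Hessian at x, so for any \<rho> the first- and
  second-order conditions of player -1 are those of W. Testing them in suitable directions yields
  each property of a saddle.\<close>

lemma strict_nash_equilibrium_imp_saddle:
  assumes V: "C_k 2 V" and d: "proximal_function d"
    and "\<alpha> + \<beta> > 1" and v: "is_v1 V x v"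
    and ev_nz: "\<And>i. i \<in> {1..CARD('n)} \<Longrightarrow> eigval i V x \<noteq> 0"
    and ev_simple: "\<And>i. i \<in> {2..CARD('n)} \<Longrightarrow> eigval i V x \<noteq> eigval 1 V x"
    and nash: "nash_equilibrium \<alpha> \<beta> \<rho> V d x x v"
  shows "index1_saddle V (x :: real ^ 'n::finite)"
proof -
  interpret symmetric_matrix "hessian V x"
    by unfold_locales (rule hessian_symmetric[OF V])
  define l where "l = eigval 1 V x"
  have unit: "norm v = 1" and ev: "v \<in> eigenspace (hessian V x) l"
    using v by (auto simp: is_v1_def l_def)
  have C2: "C_k 2 (d x)" and hess: "hessian (d x) x = 0"
    and "d x x = 0" "\<And>y. 0 \<le> d x y"
    using d by (auto simp: proximal_function_def)
  then have d_min: "d x x \<le> d x y" for y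
    by simp
  note V' = has_field_derivative_line[OF C_2_has_derivative_grad[OF V]]
  note d' = has_field_derivative_line[OF C_2_has_derivative_grad[OF C2]]
  \<comment> \<open>The cost of player -1 along x + t h, with the factor t pulled out of the
    projections.\<close>
  define \<phi> where "\<phi> h t = (1 - \<alpha>) * V (x + t *\<^sub>R h) + \<alpha> * V (x + t *\<^sub>R (h - proj v h))
      - \<beta> * V (x + t *\<^sub>R proj v h) + \<rho> * d x (x + t *\<^sub>R h)" for h t
  have \<phi>_min: "\<phi> h 0 \<le> \<phi> h t" for h t
  proof -
    have "\<phi> h s = cost_y \<alpha> \<beta> \<rho> V d (x + s *\<^sub>R h) x v" for s
      by (simp add: cost_y_def W_displacement \<phi>_def proj_def scaleR_diff_right)
    then show ?thesis
      using nash by (simp add: nash_equilibrium_def)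
  qed
  have d_crit: "grad (d x) x \<bullet> h = 0" for h
    using DERIV_local_min[OF d'[of x h 0] zero_less_one] d_min by simp
  then have d_grad: "grad (d x) x = 0"
    using inner_eq_zero_iff by blast
  have first: "(1 - \<alpha>) * (grad V x \<bullet> h) + \<alpha> * (grad V x \<bullet> (h - proj v h))
      - \<beta> * (grad V x \<bullet> proj v h) = 0" for h
  proof -
    have "(\<phi> h has_real_derivative (1 - \<alpha>) * (grad V (x + 0 *\<^sub>R h) \<bullet> h)
        + \<alpha> * (grad V (x + 0 *\<^sub>R (h - proj v h)) \<bullet> (h - proj v h))
        - \<beta> * (grad V (x + 0 *\<^sub>R proj v h) \<bullet> proj v h)
        + \<rho> * (grad (d x) (x + 0 *\<^sub>R h) \<bullet> h)) (at 0)"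
      unfolding \<phi>_def by (intro DERIV_add DERIV_diff DERIV_cmult V' d')
    from DERIV_local_min[OF this zero_less_one] \<phi>_min show ?thesis
      by (simp add: d_grad)
  qed
  \<comment> \<open>The direction v isolates the component of the gradient along v. Once that is
    zero, the gradient itself is a direction with trivial projection, and the condition reads |grad
    V x|^2 = 0.\<close>
  have "proj v v = v"
    using unit by (simp add: proj_def dot_square_norm)
  with first[of v] have "(1 - \<alpha> - \<beta>) * (grad V x \<bullet> v) = 0"
    by (simp add: algebra_simps)
  then have "grad V x \<bullet> v = 0"
    using \<open>\<alpha> + \<beta> > 1\<close> by simp
  then have "grad V x \<bullet> grad V x = 0"
    using first[of "grad V x"] by (simp add: proj_def inner_diff_right algebra_simps)
  then have crit: "grad V x = 0"
    by simp
  have second: "0 \<le> (1 - \<alpha> - \<beta>) * l * (v \<bullet> h)\<^sup>2 + (h - proj v h) \<bullet> (hessian V x *v (h - proj v h))" for h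
  proof -
    define Q where "Q k = k \<bullet> (hessian V x *v k) / 2" for k
    have "((\<lambda>t. (1 - \<alpha>) * ((V (x + t *\<^sub>R h) - V x) / t\<^sup>2)
        + \<alpha> * ((V (x + t *\<^sub>R (h - proj v h)) - V x) / t\<^sup>2)
        - \<beta> * ((V (x + t *\<^sub>R proj v h) - V x) / t\<^sup>2)
        + \<rho> * ((d x (x + t *\<^sub>R h) - d x x) / t\<^sup>2))
      \<longlongrightarrow> (1 - \<alpha>) * Q h + \<alpha> * Q (h - proj v h) - \<beta> * Q (proj v h)
        + \<rho> * (h \<bullet> (hessian (d x) x *v h) / 2)) (at 0)"
      unfolding Q_def
      by (intro tendsto_intros second_order_tendsto[OF V crit] second_order_tendsto[OF C2 d_grad])
    moreover have "(1 - \<alpha>) * ((V (x + t *\<^sub>R h) - V x) / t\<^sup>2)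
        + \<alpha> * ((V (x + t *\<^sub>R (h - proj v h)) - V x) / t\<^sup>2)
        - \<beta> * ((V (x + t *\<^sub>R proj v h) - V x) / t\<^sup>2)
        + \<rho> * ((d x (x + t *\<^sub>R h) - d x x) / t\<^sup>2) = (\<phi> h t - \<phi> h 0) / t\<^sup>2" for t
      by (simp add: \<phi>_def add_divide_distrib diff_divide_distrib algebra_simps)
    ultimately have "((\<lambda>t. (\<phi> h t - \<phi> h 0) / t\<^sup>2)
      \<longlongrightarrow> (1 - \<alpha>) * Q h + \<alpha> * Q (h - proj v h) - \<beta> * Q (proj v h)) (at 0)"
      by (simp add: hess)
    \<comment> \<open>A limit of nonnegative quotients, since \<phi> is minimal at t = 0.\<close>
    then have "0 \<le> (1 - \<alpha>) * Q h + \<alpha> * Q (h - proj v h) - \<beta> * Q (proj v h)"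
      by (rule tendsto_lowerbound) (use \<phi>_min in auto)
    then show ?thesis
      unfolding Q_def quadratic_form_split[OF unit ev, of h] quadratic_form_proj[OF unit ev, of h]
      by (simp add: field_simps)
  qed
  have "0 \<le> (1 - \<alpha> - \<beta>) * l"
    using second[of v] \<open>proj v v = v\<close> unit by (simp add: dot_square_norm)
  then have "l \<le> 0"
    using \<open>\<alpha> + \<beta> > 1\<close> by (simp add: zero_le_mult_iff)
  moreover have "l \<noteq> 0"
    using ev_nz[of 1] by (simp add: l_def Suc_le_eq)
  moreover have "0 < eigval i V x" if i: "i \<in> {2..CARD('n)}" for i
  proof -
    have "eigval i V x \<in> eigenvalues (hessian V x)"
      unfolding eigval_def set_eigenvalue_list[symmetric]
      using i length_eigenvalue_list by (intro nth_mem) auto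
    then obtain z where z: "z \<noteq> 0" "z \<in> eigenspace (hessian V x) (eigval i V x)"
      by (auto simp: eigenvalues_def)
    \<comment> \<open>Eigenvectors for distinct eigenvalues are orthogonal, so in direction z the
      second-order condition reduces to the plain form of the Hessian.\<close>
    have "v \<bullet> z = 0"
      using eigenspace_orthogonal[OF ev z(2)] ev_simple[OF i] by (auto simp: l_def orthogonal_def)
    then have "0 \<le> eigval i V x * (norm z)\<^sup>2"
      using second[of z] eigenvalue_Rayleigh[OF z(2)] by (simp add: proj_def)
    then have "0 \<le> eigval i V x"
      using z by (simp add: zero_le_mult_iff)
    moreover have "eigval i V x \<noteq> 0"
      using i by (intro ev_nz) auto
    ultimately show ?thesis
      by simp
  qed
  ultimately show ?thesis
    using crit by (simp add: index1_saddle_def l_def)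
qed

theorem theorem6:
  fixes V :: "real ^ 'n::finite \<Rightarrow> real" and d :: "real ^ 'n \<Rightarrow> real ^ 'n \<Rightarrow> real"
    and \<alpha> \<beta> :: real
  assumes "admissible_potential V" and "proximal_function d" and "\<alpha> + \<beta> > 1"
  shows "\<exists>\<rho>\<^sub>0>0. \<forall>\<rho>>\<rho>\<^sub>0. \<forall>x v. is_v1 V x v \<longrightarrow>
           (index1_saddle V x \<longleftrightarrow> strict_nash_equilibrium \<alpha> \<beta> \<rho> V d x x v)"
proof -
  have "C_k (Suc 2) V"
    using assms(1) by (simp add: admissible_potential_def numeral_3_eq_3 numeral_2_eq_2)
  then have V: "C_k 2 V"
    by (rule C_k_Suc_imp_C_k)
  obtain L where Lip: "L-lipschitz_on UNIV V"
    using assms(1) by (auto simp: admissible_potential_def)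
  \<comment> \<open>All pairs of a saddle and one of its unit eigenvectors: finitely many saddles,
    at most two vectors each.\<close>
  define P where "P = (SIGMA x:{x. index1_saddle V x}. {v. is_v1 V x v})"
  have "finite {v. is_v1 V x v}" if saddle: "index1_saddle V x" for x
  proof (cases "\<exists>v. is_v1 V x v")
    case True
    then obtain v where "is_v1 V x v" ..
    then have "{v. is_v1 V x v} \<subseteq> {v, - v}"
      using is_v1_unique[OF V saddle] by blast
    then show ?thesis
      by (rule finite_subset) simp
  qed simp
  then have "finite P"
    using assms(1) by (auto simp: P_def admissible_potential_def)
  moreover have "\<forall>\<^sub>F \<rho> in at_top. strict_nash_equilibrium \<alpha> \<beta> \<rho> V d (fst p) (fst p) (snd p)"
    if "p \<in> P" for p
    using that by (intro saddle_imp_strict_nash_equilibrium[OF V Lip assms(2,3)]) (auto simp: P_def)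
  \<comment> \<open>Finitely many statements that hold for all large \<rho> hold together from one
    bound on.\<close>
  ultimately have "\<forall>\<^sub>F \<rho> in at_top. \<forall>p\<in>P. strict_nash_equilibrium \<alpha> \<beta> \<rho> V d (fst p) (fst p) (snd p)"
    by (simp add: eventually_ball_finite)
  then obtain N where N: "\<And>\<rho> p. \<lbrakk>N \<le> \<rho>; p \<in> P\<rbrakk> \<Longrightarrow>
      strict_nash_equilibrium \<alpha> \<beta> \<rho> V d (fst p) (fst p) (snd p)"
    by (auto simp: eventually_at_top_linorder)
  \<comment> \<open>Taking the maximum with 1 keeps the threshold positive.\<close>
  have "index1_saddle V x \<longleftrightarrow> strict_nash_equilibrium \<alpha> \<beta> \<rho> V d x x v"
    if \<rho>: "max N 1 < \<rho>" and v: "is_v1 V x v" for \<rho> x v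
  proof
    assume "index1_saddle V x"
    then show "strict_nash_equilibrium \<alpha> \<beta> \<rho> V d x x v"
      using N[of \<rho> "(x, v)"] \<rho> v by (simp add: P_def)
  next
    assume "strict_nash_equilibrium \<alpha> \<beta> \<rho> V d x x v"
    then have nash: "nash_equilibrium \<alpha> \<beta> \<rho> V d x x v"
      by (simp add: strict_nash_equilibrium_def)
    have "\<forall>i \<in> {1..CARD('n)}. eigval i V x \<noteq> 0 \<and>
        (\<forall>j \<in> {1..CARD('n)}. i \<noteq> j \<longrightarrow> eigval i V x \<noteq> eigval j V x)"
      using assms(1) unfolding admissible_potential_def by blast
    then show "index1_saddle V x"
      by (intro strict_nash_equilibrium_imp_saddle[OF V assms(2,3) v _ _ nash]) auto
  qed
  then show ?thesis
    by (intro exI[of _ "max N 1"]) auto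
qed

end
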